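(* Let $a, k, q, m$ be positive integers such that $a$ and $k$ are coprime, and set $\mathbf{a} = (a, k+a, 2k+a, \ldots, mk+a)$, so that $q\cdot\mathbf{a} = (qa, q(k+a), q(2k+a), \ldots, q(mk+a))$. Then the symmetry group of the graph of the curve $\gamma_{q\cdot\mathbf{a}}$, where $$\gamma_{q\cdot \mathbf{a}}(t) = \sum_{j=0}^m \exp\bigl(2\pi i\, q(jk+a)\, t\bigr),$$ is the dihedral group $D_k$.
   Context: For a vector $\mathbf{a}=(a_0,\ldots,a_m)$ of positive integers with $m\ge 1$, the closed curve $\gamma_{\mathbf{a}}:\mathbb{R}\to\mathbb{C}$ is defined by $\gamma_{\mathbf{a}}(t)=\sum_{j=0}^m \exp(2\pi i a_j t)$; it is one-periodic. The "graph" of the curve means its image $\{\gamma_{\mathbf{a}}(t): t\in[0,1]\}$ as a subset of $\mathbb{C}\cong\mathbb{R}^2$. The symmetry group of a set $X\subset\mathbb{R}^2$ is the group, under composition, of all isometries of the plane that leave $X$ invariant (map $X$ onto $X$). The dihedral group $D_n$ is the group with $2n$ elements consisting of the rotations about a fixed point by multiples of the angle $2\pi/n$, together with the reflections in $n$ axes that all pass through this fixed point. *)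

theory Defs
  imports Complex_Main "HOL-Algebra.Coset"
begin

definition exp_curve :: "nat \<Rightarrow> (nat \<Rightarrow> nat) \<Rightarrow> real \<Rightarrow> complex" where
  "exp_curve m a t = (\<Sum>j=0..m. exp (2 * of_real pi * \<i> * of_nat (a j) * of_real t))"

definition curve_graph :: "(real \<Rightarrow> complex) \<Rightarrow> complex set" where
  "curve_graph \<gamma> = \<gamma> ` {0..1}"

definition plane_isometry :: "(complex \<Rightarrow> complex) \<Rightarrow> bool" where
  "plane_isometry f \<longleftrightarrow> (\<forall>z w. dist (f z) (f w) = dist z w)"

definition composition_monoid :: "('a \<Rightarrow> 'a) set \<Rightarrow> ('a \<Rightarrow> 'a) monoid" where
  "composition_monoid S = \<lparr>carrier = S, monoid.mult = (\<circ>), one = id\<rparr>"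

definition symmetry_group :: "complex set \<Rightarrow> (complex \<Rightarrow> complex) monoid" where
  "symmetry_group X = composition_monoid {f. plane_isometry f \<and> f ` X = X}"

definition rotation :: "complex \<Rightarrow> real \<Rightarrow> complex \<Rightarrow> complex" where
  "rotation c \<phi> z = c + cis \<phi> * (z - c)"

(* The axis is the line through c with direction cis \<theta>; every line through c
   arises from exactly one \<theta> in {0..<pi}. *)
definition reflection :: "complex \<Rightarrow> real \<Rightarrow> complex \<Rightarrow> complex" where
  "reflection c \<theta> z = c + cis \<theta> * cnj (cis (- \<theta>) * (z - c))"

(* \<Theta> holds the direction angles of the n axes. That they are equally spaced is not
   imposed: it follows from closure under composition. *)
definition is_dihedral_group :: "nat \<Rightarrow> (complex \<Rightarrow> complex) monoid \<Rightarrow> bool" where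
  "is_dihedral_group n G \<longleftrightarrow>
     group G \<and> order G = 2 * n \<and>
     (\<exists>c \<Theta>. \<Theta> \<subseteq> {0..<pi} \<and> card \<Theta> = n \<and>
        G = composition_monoid
              (range (\<lambda>j::int. rotation c (of_int j * (2 * pi / of_nat n))) \<union>
               reflection c ` \<Theta>))"

end

theory Submission
  imports Defs
    "HOL-Analysis.Elementary_Metric_Spaces"
    "HOL-Computational_Algebra.Field_as_Ring"
    "HOL-Computational_Algebra.Fundamental_Theorem_Algebra"
    "Subresultants.Subresultant_Gcd"
begin

text \<open>
  The graph is the image of the unit circle under the polynomial
  \<open>p(z) = z\<^sup>a (1 + z\<^sup>k + \<dots> + z\<^sup>m\<^sup>k)\<close>, and it is invariant under conjugation, so an
  isometry preserving it may be assumed to be \<open>w \<mapsto> \<alpha> w + \<beta>\<close>. Each \<open>z\<close> on the circle then has a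
  partner \<open>w\<close> on the circle with \<open>p(w) = \<alpha> p(z) + \<beta>\<close>; conjugating gives
  \<open>p(1/w) = cnj \<alpha> p(1/z) + cnj \<beta>\<close>. These are two polynomial equations in \<open>(z, w)\<close> whose resultant
  in \<open>w\<close> has infinitely many roots, so it vanishes identically and the two equations have a common
  solution \<open>w\<close> for every large \<open>z\<close>. As \<open>z \<rightarrow> \<infinity>\<close> the first equation forces \<open>w \<rightarrow> \<infinity>\<close>, and since
  \<open>p(0) = 0\<close> the second one becomes \<open>0 = cnj \<beta>\<close>. Hence the isometry fixes the origin and permutes
  the points of maximal modulus \<open>m + 1\<close>, which are \<open>(m + 1) u\<close> with \<open>u\<^sup>k = 1\<close>.
\<close>

section \<open>Resultants and common roots over the complex numbers\<close>

text \<open>The resultant vanishes exactly when the gcd has positive degree, that is, when the gcd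
  has a root by the fundamental theorem of algebra. \<open>f \<noteq> 0\<close> excludes a zero gcd,
  which has degree 0 but vanishes everywhere.\<close>

lemma resultant_eq_0_iff_common_root:
  fixes f g :: "complex poly"
  assumes "f \<noteq> 0"
  shows "resultant f g = 0 \<longleftrightarrow> (\<exists>w. poly f w = 0 \<and> poly g w = 0)"
proof -
  have "degree (gcd f g) \<noteq> 0 \<longleftrightarrow> (\<exists>w. poly (gcd f g) w = 0)"
    using assms constant_degree[of "gcd f g"] fundamental_theorem_of_algebra[of "gcd f g"]
    by (metis degree_eq_zeroE gcd_eq_0_iff pCons_0_0 poly_pCons poly_0 mult_zero_right add.right_neutral)
  also have "\<dots> \<longleftrightarrow> (\<exists>w. poly f w = 0 \<and> poly g w = 0)"
    by (simp add: poly_eq_0_iff_dvd)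
  finally show ?thesis by (simp add: resultant_0_gcd)
qed

text \<open>Specialising at \<open>z\<close> commutes with the resultant where both leading coefficients survive.\<close>

lemma common_root_persists:
  fixes A B :: "complex poly poly"
  defines "ev \<equiv> \<lambda>z. map_poly (\<lambda>p. poly p z)"
  assumes "A \<noteq> 0" "B \<noteq> 0"
    and inf: "infinite {z. \<exists>w. poly (ev z A) w = 0 \<and> poly (ev z B) w = 0}"
    and z: "poly (lead_coeff A) z \<noteq> 0" "poly (lead_coeff B) z \<noteq> 0"
  shows "\<exists>w. poly (ev z A) w = 0 \<and> poly (ev z B) w = 0"
proof -
  have nz: "ev x A \<noteq> 0" and
    res: "resultant (ev x A) (ev x B) = poly (resultant A B) x"
    if "poly (lead_coeff A) x \<noteq> 0" "poly (lead_coeff B) x \<noteq> 0" for x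
  proof -
    have hom: "comm_ring_hom (\<lambda>p. poly p x)" by unfold_locales auto
    have "degree (ev x A) = degree A" "degree (ev x B) = degree B"
      using that by (auto simp: ev_def intro!: map_poly_degree_eq)
    then show "resultant (ev x A) (ev x B) = poly (resultant A B) x"
      unfolding ev_def by (rule comm_ring_hom.resultant_map_poly[OF hom])
    show "ev x A \<noteq> 0" using that(1) by (metis coeff_0 coeff_map_poly ev_def poly_0)
  qed
  \<comment> \<open>\<open>E\<close> holds the finitely many points where a leading coefficient
    drops out. Off \<open>E\<close>, a common root at \<open>x\<close> makes \<open>x\<close> a root
    of \<open>resultant A B\<close>, which is therefore zero.\<close>
  define E where "E = {x. poly (lead_coeff A * lead_coeff B) x = 0}"
  have "finite E" unfolding E_def using assms(2,3) by (intro poly_roots_finite) auto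
  with inf have "infinite ({x. \<exists>w. poly (ev x A) w = 0 \<and> poly (ev x B) w = 0} - E)"
    by (rule Diff_infinite_finite[rotated])
  moreover have "{x. \<exists>w. poly (ev x A) w = 0 \<and> poly (ev x B) w = 0} - E
      \<subseteq> {x. poly (resultant A B) x = 0}"
  proof (rule subsetI)
    fix x assume "x \<in> {x. \<exists>w. poly (ev x A) w = 0 \<and> poly (ev x B) w = 0} - E"
    then have x: "poly (lead_coeff A) x \<noteq> 0" "poly (lead_coeff B) x \<noteq> 0"
      and "\<exists>w. poly (ev x A) w = 0 \<and> poly (ev x B) w = 0"
      by (auto simp: E_def)
    then have "resultant (ev x A) (ev x B) = 0"
      by (simp add: resultant_eq_0_iff_common_root nz)
    then show "x \<in> {x. poly (resultant A B) x = 0}" using res[OF x] by simp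
  qed
  ultimately have "resultant A B = 0"
    using poly_roots_finite finite_subset by blast
  with res[OF z] nz[OF z] show ?thesis
    by (simp add: resultant_eq_0_iff_common_root)
qed

section \<open>Affine maps preserving a polynomial image of the circle\<close>

lemma affine_symmetry_polynomial_circle_linear:
  fixes p :: "complex poly"
  assumes p0: "poly p 0 = 0" and "p \<noteq> 0" and \<alpha>: "\<alpha> \<noteq> 0"
    and sub: "(\<lambda>w. \<alpha> * w + \<beta>) ` poly p ` sphere 0 1 \<subseteq> poly p ` sphere 0 1"
  shows "\<beta> = 0"
proof -
  define N where "N = degree p"
  define r where "r = reflect_poly (map_poly cnj p)"
  \<comment> \<open>\<open>r(z) = z\<^sup>N cnj (p(1 / cnj z))\<close>; as polynomials in \<open>w\<close>, \<open>A\<close> and \<open>B\<close> encode the two equations,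
    the second one multiplied by \<open>(z w)\<^sup>N\<close>.\<close>
  define A where "A = map_poly (\<lambda>c. [:c:]) p - [: Polynomial.smult \<alpha> p + [:\<beta>:] :]"
  define L where "L = - (Polynomial.smult (cnj \<alpha>) r + monom (cnj \<beta>) N)"
  define B where "B = Polynomial.smult (monom 1 N) (map_poly (\<lambda>c. [:c:]) r) + monom L N"
  define ev where "ev = (\<lambda>z. map_poly (\<lambda>q. poly q (z::complex)))"
  have N: "N > 0"
    using p0 \<open>p \<noteq> 0\<close> by (metis N_def degree_eq_zeroE gr0I pCons_0_0 poly_0 poly_pCons mult_zero_left add.right_neutral)
  have r: "poly r z = z ^ N * cnj (poly p (inverse (cnj z)))" if "z \<noteq> 0" for z
    using that by (simp add: r_def N_def poly_reflect_poly_nz degree_map_poly)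
  have evA: "poly (ev z A) w = poly p w - (\<alpha> * poly p z + \<beta>)" for z w
  proof -
    have "ev z A = p - [:\<alpha> * poly p z + \<beta>:]"
      by (rule poly_eqI) (simp add: ev_def A_def coeff_map_poly coeff_pCons split: nat.split)
    then show ?thesis by simp
  qed
  have evB: "poly (ev z B) w = z ^ N * poly r w + poly L z * w ^ N" for z w
  proof -
    have "ev z B = Polynomial.smult (z ^ N) r + monom (poly L z) N"
      by (rule poly_eqI) (simp add: ev_def B_def coeff_map_poly poly_monom)
    then show ?thesis by (simp add: poly_monom)
  qed
  \<comment> \<open>The constant coefficient of \<open>r\<close> is
    \<open>cnj (lead_coeff p)\<close>, and the monomial in \<open>L\<close> does not reach it
    because \<open>N > 0\<close>. So \<open>L\<close> has only finitely many roots.\<close>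
  have L0: "coeff L 0 \<noteq> 0" using \<alpha> N \<open>p \<noteq> 0\<close>
    by (simp add: L_def r_def degree_map_poly coeff_map_poly)
  have dA: "degree A = N" "lead_coeff A = [:lead_coeff p:]"
  proof -
    have "degree (map_poly (\<lambda>c. [:c:]) p) = N" by (simp add: N_def degree_map_poly)
    then show 1: "degree A = N" unfolding A_def using N
      by (metis degree_pCons_0 degree_add_eq_left degree_minus diff_conv_add_uminus)
    show "lead_coeff A = [:lead_coeff p:]"
      unfolding 1 using N by (simp add: A_def coeff_map_poly coeff_pCons N_def split: nat.split)
  qed
  \<comment> \<open>Reversal turns \<open>poly p 0 = 0\<close> into a degree of \<open>r\<close>
    below \<open>N\<close>, so the coefficient of \<open>B\<close> at \<open>N\<close> is exactly
    \<open>L\<close>.\<close>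
  have rN: "coeff r n = 0" if "n \<ge> N" for n
    using that p0 by (auto simp: r_def coeff_reflect_poly N_def degree_map_poly coeff_map_poly poly_0_coeff_0)
  have dB: "degree B = N" "lead_coeff B = L"
  proof -
    have *: "coeff B N = L" using rN by (simp add: B_def coeff_map_poly)
    have "degree B \<le> N"
      by (rule degree_le) (auto simp: B_def coeff_map_poly rN)
    moreover have "L \<noteq> 0" using L0 by auto
    ultimately show 1: "degree B = N" using * by (metis le_degree le_antisym)
    show "lead_coeff B = L" using * 1 by simp
  qed
  have unit: "\<exists>w. poly (ev z A) w = 0 \<and> poly (ev z B) w = 0" if z: "norm z = 1" for z
  proof -
    have "\<alpha> * poly p z + \<beta> \<in> poly p ` sphere 0 1"
      by (rule subsetD[OF sub], intro imageI) (simp add: z)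
    then obtain w where w: "norm w = 1" "poly p w = \<alpha> * poly p z + \<beta>" by auto
    \<comment> \<open>The circle is fixed pointwise by inversion, so there the second equation is
      just the conjugate of the first.\<close>
    have inv: "inverse (cnj u) = u" if "norm u = 1" for u
      using that by (metis complex_cnj_cnj complex_norm_square inverse_unique mult.commute of_real_1 power_one)
    have "z \<noteq> 0" "w \<noteq> 0" using z w(1) by auto
    then show ?thesis
      by (intro exI[of _ w])
        (simp add: evA evB w L_def poly_monom r inv z algebra_simps)
  qed
  have root: "\<exists>w. poly (ev z A) w = 0 \<and> poly (ev z B) w = 0" if "poly L z \<noteq> 0" for z
    unfolding ev_def
  proof (rule common_root_persists)
    show "A \<noteq> 0" "B \<noteq> 0" using dA dB L0 \<open>p \<noteq> 0\<close> by auto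
    have "infinite (sphere 0 1 :: complex set)"
    proof
      assume "finite (sphere 0 1 :: complex set)"
      moreover have "cis ` {0..1} \<subseteq> sphere 0 1" by auto
      ultimately have "finite (cis ` {0..1})" by (rule finite_subset[rotated])
      moreover have "inj_on cis {0..1}"
      proof (rule inj_onI)
        fix x y :: real assume xy: "x \<in> {0..1}" "y \<in> {0..1}" and eq: "cis x = cis y"
        have "cos x = cos y" using arg_cong[OF eq, of Re] by simp
        moreover have "x \<le> pi" "y \<le> pi" using xy pi_ge_two by simp_all
        ultimately show "x = y" using xy cos_inj_pi[of x y] by simp
      qed
      ultimately have "finite {0..1::real}" by (rule finite_imageD)
      then show False using infinite_Icc[of "0::real" 1] by simp
    qed
    then show "infinite {z. \<exists>w. poly (map_poly (\<lambda>q. poly q z) A) w = 0 \<and> poly (map_poly (\<lambda>q. poly q z) B) w = 0}"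
      using unit unfolding ev_def by (elim infinite_super[rotated]) auto
    show "poly (lead_coeff A) z \<noteq> 0" "poly (lead_coeff B) z \<noteq> 0"
      using dA dB that \<open>p \<noteq> 0\<close> by auto
  qed
  have ev_nz: "eventually (\<lambda>z. poly L z \<noteq> 0 \<and> z \<noteq> 0) at_infinity"
  proof -
    define S where "S = insert 0 {z. poly L z = 0}"
    have "finite S" using L0 by (auto simp: S_def intro!: poly_roots_finite)
    then have "norm z \<le> Max (norm ` S)" if "z \<in> S" for z using that by simp
    then show ?thesis unfolding eventually_at_infinity
      by (intro exI[of _ "Max (norm ` S) + 1"]) (force simp: S_def)
  qed
  \<comment> \<open>\<open>W z\<close> is known to be a common root only where
    \<open>poly L z \<noteq> 0\<close>, which holds for all large \<open>z\<close>.\<close>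
  define W where "W z = (SOME w. poly (ev z A) w = 0 \<and> poly (ev z B) w = 0)" for z
  have W: "poly p (W z) = \<alpha> * poly p z + \<beta>"
    "W z \<noteq> 0" "cnj (poly p (inverse (cnj (W z)))) = cnj \<alpha> * cnj (poly p (inverse (cnj z))) + cnj \<beta>"
    if "poly L z \<noteq> 0" "z \<noteq> 0" for z
  proof -
    have *: "poly (ev z A) (W z) = 0" "poly (ev z B) (W z) = 0"
      using someI_ex[OF root[OF that(1)]] by (auto simp: W_def)
    show "poly p (W z) = \<alpha> * poly p z + \<beta>" using *(1) by (simp add: evA)
    \<comment> \<open>At \<open>w = 0\<close> the second equation reads
      \<open>z ^ N * poly r 0 = 0\<close>. Excluding this allows division by
      \<open>z ^ N * W z ^ N\<close> below.\<close>
    have "poly r 0 \<noteq> 0" using \<open>p \<noteq> 0\<close> by (simp add: r_def poly_0_coeff_0 coeff_map_poly degree_map_poly)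
    then show Wnz: "W z \<noteq> 0" using *(2) that(2) N by (auto simp: evB power_0_left)
    show "cnj (poly p (inverse (cnj (W z)))) = cnj \<alpha> * cnj (poly p (inverse (cnj z))) + cnj \<beta>"
      using *(2) that(2) Wnz
        mult_cancel_left[of "z ^ N * W z ^ N" "cnj (poly p (inverse (cnj (W z))))"
          "cnj \<alpha> * cnj (poly p (inverse (cnj z))) + cnj \<beta>"]
      by (simp add: evB L_def r poly_monom algebra_simps)
  qed
  have pinf: "filterlim (poly p) at_infinity at_infinity"
    using N unfolding N_def by (rule filterlim_poly_at_infinity)
  have lim: "filterlim (\<lambda>z. \<alpha> * poly p z + \<beta>) at_infinity at_infinity"
    using \<alpha> by (intro tendsto_add_filterlim_at_infinity'[OF _ tendsto_const]
      tendsto_mult_filterlim_at_infinity[OF tendsto_const _ pinf])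
  have eq: "eventually (\<lambda>z. \<alpha> * poly p z + \<beta> = poly p (W z)) at_infinity"
    using ev_nz by eventually_elim (use W in simp)
  have pW: "filterlim (\<lambda>z. poly p (W z)) at_infinity at_infinity"
    using lim by (simp only: filterlim_cong[OF refl refl eq])
  \<comment> \<open>A polynomial is bounded on bounded sets, so \<open>W z\<close> must leave every
    disc once \<open>poly p (W z)\<close> does.\<close>
  have Winf: "filterlim W at_infinity at_infinity"
    unfolding filterlim_at_infinity[OF order_refl]
  proof (intro allI impI)
    fix b :: real assume "b > 0"
    obtain M where M: "M > 0" "\<And>w. norm w \<le> b \<Longrightarrow> norm (poly p w) \<le> M"
      using poly_bound_exists[of b p] by blast
    have "eventually (\<lambda>z. norm (poly p (W z)) \<ge> M + 1) at_infinity"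
      using pW[unfolded filterlim_at_infinity[OF order_refl]] M(1) by simp
    then show "eventually (\<lambda>z. b \<le> norm (W z)) at_infinity"
    proof eventually_elim
      case (elim z)
      then show ?case using M(2)[of "W z"] by linarith
    qed
  qed
  have inv0: "((\<lambda>z. cnj (poly p (inverse (cnj (V z))))) \<longlongrightarrow> 0) at_infinity"
    if "filterlim V at_infinity at_infinity" for V
  proof -
    have "((\<lambda>z. cnj (inverse (V z))) \<longlongrightarrow> cnj 0) at_infinity"
      by (intro tendsto_cnj filterlim_compose[OF tendsto_inverse_0 that])
    then have "((\<lambda>z. poly p (inverse (cnj (V z)))) \<longlongrightarrow> poly p 0) at_infinity"
      by (intro isCont_tendsto_compose[OF poly_isCont]) simp
    then have "((\<lambda>z. cnj (poly p (inverse (cnj (V z))))) \<longlongrightarrow> cnj (poly p 0)) at_infinity"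
      by (rule tendsto_cnj)
    then show ?thesis using p0 by simp
  qed
  have lim: "((\<lambda>z. cnj (poly p (inverse (cnj (W z)))) - cnj \<alpha> * cnj (poly p (inverse (cnj z))))
      \<longlongrightarrow> 0 - cnj \<alpha> * 0) at_infinity"
    by (intro tendsto_intros inv0 Winf filterlim_ident)
  have eq: "eventually (\<lambda>z. cnj (poly p (inverse (cnj (W z)))) - cnj \<alpha> * cnj (poly p (inverse (cnj z)))
      = cnj \<beta>) at_infinity"
    using ev_nz by eventually_elim (use W in simp)
  have "((\<lambda>z::complex. cnj \<beta>) \<longlongrightarrow> 0) at_infinity"
    using lim by (simp add: tendsto_cong[OF eq])
  \<comment> \<open>Along the natural numbers the limit becomes that of a constant sequence.\<close>
  then show "\<beta> = 0"
    using filterlim_compose[of "\<lambda>z::complex. cnj \<beta>" "nhds 0", OF _ tendsto_of_nat]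
    by (simp add: LIMSEQ_const_iff)
qed

section \<open>Plane isometries in complex form\<close>

text \<open>Normalise to an isometry \<open>g\<close> fixing 0 and 1. Distances to 0 and 1 determine
  the real part of \<open>g z\<close>, and the imaginary part up to sign.\<close>

lemma plane_isometry_cases:
  assumes "plane_isometry f"
  obtains \<alpha> \<beta> where "norm \<alpha> = 1" "f = (\<lambda>z. \<alpha> * z + \<beta>) \<or> f = (\<lambda>z. \<alpha> * cnj z + \<beta>)"
proof -
  define \<beta> where "\<beta> = f 0"
  define \<alpha> where "\<alpha> = f 1 - f 0"
  define g where "g z = (f z - \<beta>) / \<alpha>" for z
  have iso: "dist (f z) (f w) = dist z w" for z w
    using assms by (simp add: plane_isometry_def)
  have \<alpha>: "norm \<alpha> = 1" using iso[of 1 0] by (simp add: \<alpha>_def dist_norm)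
  then have "\<alpha> \<noteq> 0" by auto
  then have f: "f z = \<alpha> * g z + \<beta>" for z by (simp add: g_def)
  have g: "norm (g z - g w) = norm (z - w)" for z w
  proof -
    have "g z - g w = (f z - f w) / \<alpha>" by (simp add: g_def diff_divide_distrib)
    then show ?thesis using iso[of z w] \<alpha> by (simp add: norm_divide dist_norm)
  qed
  have g01: "g 0 = 0" "g 1 = 1" using \<open>\<alpha> \<noteq> 0\<close> by (auto simp: g_def \<alpha>_def \<beta>_def)
  have sq: "(Re (g z) - Re (g w))\<^sup>2 + (Im (g z) - Im (g w))\<^sup>2 = (Re z - Re w)\<^sup>2 + (Im z - Im w)\<^sup>2" for z w
    using g[of z w] by (simp add: cmod_def)
  have Re: "Re (g z) = Re z" for z
    using sq[of z 0] sq[of z 1] by (simp add: g01 power2_eq_square algebra_simps)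
  then have Im2: "(Im (g z))\<^sup>2 = (Im z)\<^sup>2" for z using sq[of z 0] by (simp add: g01)
  \<comment> \<open>The distance to \<open>g \<i>\<close> shows that the sign is the same for all
    \<open>z\<close>.\<close>
  have Im: "Im (g z) * Im (g \<i>) = Im z" for z
    using sq[of z \<i>] Im2[of z] Im2[of \<i>] by (simp add: Re power2_eq_square algebra_simps)
  consider "Im (g \<i>) = 1" | "Im (g \<i>) = -1" using Im2[of \<i>] by (auto simp: power2_eq_1_iff)
  then have "g = (\<lambda>z. z) \<or> g = cnj"
  proof cases
    case 1
    then show ?thesis using Re Im by (auto simp: complex_eq_iff)
  next
    case 2
    then have "g z = cnj z" for z using Re[of z] Im[of z] by (auto simp: complex_eq_iff)
    then show ?thesis by auto
  qed
  then have "f = (\<lambda>z. \<alpha> * z + \<beta>) \<or> f = (\<lambda>z. \<alpha> * cnj z + \<beta>)" using f by auto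
  with \<alpha> that show ?thesis by blast
qed

text \<open>Equality in the triangle inequality: the other \<open>m - 1\<close> terms contribute at
  most \<open>m - 1\<close>, so \<open>1 + y\<close> has norm at least 2, which forces
  \<open>Re y \<ge> 1\<close>.\<close>

lemma norm_geometric_sum_max:
  fixes y :: complex
  assumes y: "norm y = 1" and "m > 0" and max: "norm (\<Sum>j\<le>m. y ^ j) = m + 1"
  shows "y = 1"
proof -
  have "(\<Sum>j\<le>m. y ^ j) = 1 + y + (\<Sum>j\<in>{2..m}. y ^ j)"
  proof -
    have "{..m} = {0, 1} \<union> {2..m}" using \<open>m > 0\<close> by auto
    then show ?thesis by (simp add: sum.union_disjoint)
  qed
  moreover have "norm (\<Sum>j\<in>{2..m}. y ^ j) \<le> real m - 1"
    using sum_norm_le[of "{2..m}" "\<lambda>j. y ^ j" "\<lambda>_. 1"] y \<open>m > 0\<close> by (simp add: norm_power)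
  ultimately have "norm (1 + y) \<ge> 2"
    using max norm_triangle_ineq[of "1 + y" "\<Sum>j\<in>{2..m}. y ^ j"] by simp
  then have "(norm (1 + y))\<^sup>2 \<ge> 2\<^sup>2" by (rule power_mono) simp
  moreover have y2: "(Re y)\<^sup>2 + (Im y)\<^sup>2 = 1" using y by (metis cmod_power2 one_power2)
  ultimately have "Re y \<ge> 1" unfolding cmod_power2 by (simp add: power2_eq_square algebra_simps)
  then have "(Re y)\<^sup>2 \<ge> 1\<^sup>2" by (intro power_mono) auto
  with y2 have "(Im y)\<^sup>2 \<le> 0" unfolding one_power2 by linarith
  then have "Im y = 0" by (metis power2_less_eq_zero_iff)
  with y2 have "(Re y)\<^sup>2 = 1" by simp
  with \<open>Re y \<ge> 1\<close> \<open>Im y = 0\<close> show ?thesis by (auto simp: complex_eq_iff power2_eq_1_iff)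
qed

section \<open>The curve as a polynomial image of the circle\<close>

definition progression_poly :: "nat \<Rightarrow> nat \<Rightarrow> nat \<Rightarrow> complex poly" where
  "progression_poly a k m = (\<Sum>j\<le>m. monom 1 (j * k + a))"

lemma poly_progression_poly:
  "poly (progression_poly a k m) z = z ^ a * (\<Sum>j\<le>m. (z ^ k) ^ j)"
  by (simp add: progression_poly_def poly_sum poly_monom power_add power_mult sum_distrib_left
      mult.commute flip: power_mult)

lemma exp_curve_progression:
  "exp_curve m (\<lambda>j. q * (j * k + a)) t = poly (progression_poly a k m) (cis (2 * pi * q * t))"
proof -
  have "exp (2 * of_real pi * \<i> * of_nat (q * n) * of_real t) = cis (2 * pi * q * t) ^ n" for n :: nat
    unfolding DeMoivre unfolding cis_conv_exp by (simp add: mult_ac)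
  then show ?thesis
    by (simp only: exp_curve_def progression_poly_def poly_sum poly_monom atLeast0AtMost mult_1)
qed

text \<open>The factor \<open>q\<close> only makes the parameter run \<open>q\<close> times around
  the circle, so the image does not depend on it.\<close>

lemma curve_graph_progression:
  assumes "q > 0"
  shows "curve_graph (exp_curve m (\<lambda>j. q * (j * k + a))) = poly (progression_poly a k m) ` sphere 0 1"
proof -
  have "(\<lambda>t. cis (2 * pi * q * t)) ` {0..1} = sphere 0 1"
  proof (intro equalityI subsetI)
    fix z :: complex assume z: "z \<in> sphere 0 1"
    then have "z \<noteq> 0" by auto
    with z have z': "cis (Arg z) = z" by (simp add: cis_Arg sgn_eq)
    \<comment> \<open>The argument moved into \<open>[0, 2 * pi]\<close>, so that dividing by
      \<open>2 * pi * q\<close> gives a parameter in \<open>[0, 1]\<close>.\<close>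
    define \<theta> where "\<theta> = (if Arg z < 0 then Arg z + 2 * pi else Arg z)"
    have "cis \<theta> = z" using z' by (auto simp: \<theta>_def simp flip: cis_mult)
    moreover have "0 \<le> \<theta>" "\<theta> \<le> 2 * pi"
      using Arg_bounded[of z] by (auto simp: \<theta>_def)
    moreover from this(2) have "\<theta> \<le> 2 * pi * q"
      by (rule order_trans) (use assms in simp)
    ultimately have "z = cis (2 * pi * q * (\<theta> / (2 * pi * q)))" "\<theta> / (2 * pi * q) \<in> {0..1}"
      using assms by simp_all
    then show "z \<in> (\<lambda>t. cis (2 * pi * q * t)) ` {0..1}" by blast
  qed auto
  moreover have "exp_curve m (\<lambda>j. q * (j * k + a))
      = poly (progression_poly a k m) \<circ> (\<lambda>t. cis (2 * pi * q * t))"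
    by (auto simp: exp_curve_progression)
  ultimately show ?thesis unfolding curve_graph_def by (simp only: image_comp[symmetric])
qed

text \<open>The coefficients are real, so conjugation commutes with the polynomial, and it permutes
  the circle.\<close>

lemma cnj_image_progression:
  "cnj ` poly (progression_poly a k m) ` sphere 0 1 = poly (progression_poly a k m) ` sphere 0 1"
proof -
  let ?p = "poly (progression_poly a k m)"
  have "cnj \<circ> ?p = ?p \<circ> cnj" by (auto simp: poly_progression_poly)
  moreover have "cnj ` sphere 0 1 = sphere 0 1"
    by (auto intro: image_eqI[where f = cnj and x = "cnj z" and b = z for z])
  ultimately show ?thesis by (metis image_comp)
qed

section \<open>Roots of unity and the symmetries of the graph\<close>

lemma norm_root_unity:
  fixes u :: complex
  assumes "u ^ k = 1" "k > 0"
  shows "norm u = 1"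
  using assms by (metis norm_one norm_power norm_ge_zero power_eq_imp_eq_base power_one)

text \<open>Take \<open>v = u ^ x\<close> with \<open>x\<close> an inverse of \<open>a\<close>
  modulo \<open>k\<close>.\<close>

lemma root_unity_coprime_power:
  fixes u :: complex
  assumes "u ^ k = 1" "coprime a k" "a > 0"
  obtains v where "v ^ k = 1" "v ^ a = u"
proof -
  obtain x y where "a * x = k * y + 1"
    using bezout_nat[of a k] assms by auto
  then have "(u ^ x) ^ a = u" using assms(1) by (metis mult.commute power_add power_mult power_one power_one_right mult_1)
  moreover have "(u ^ x) ^ k = 1" using assms(1) by (metis mult.commute power_mult power_one)
  ultimately show ?thesis using that by blast
qed

lemma symmetries_progression:
  fixes a k m :: nat
  assumes "a > 0" "k > 0" "m > 0" "coprime a k"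
  defines "X \<equiv> poly (progression_poly a k m) ` sphere 0 1" and "U \<equiv> {u::complex. u ^ k = 1}"
  shows "{f. plane_isometry f \<and> f ` X = X} = (\<lambda>u z. u * z) ` U \<union> (\<lambda>u z. u * cnj z) ` U"
proof (intro equalityI subsetI)
  fix f assume f: "f \<in> {f. plane_isometry f \<and> f ` X = X}"
  then obtain \<alpha> \<beta> where \<alpha>: "norm \<alpha> = 1"
    and f_cases: "f = (\<lambda>z. \<alpha> * z + \<beta>) \<or> f = (\<lambda>z. \<alpha> * cnj z + \<beta>)"
    using plane_isometry_cases by blast
  \<comment> \<open>Precomposing with \<open>cnj\<close> reduces the orientation-reversing case to
    the affine one.\<close>
  have "f ` cnj ` X = X" using f cnj_image_progression by (auto simp: X_def)
  then have aff: "(\<lambda>w. \<alpha> * w + \<beta>) ` X = X" using f f_cases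
    by (elim disjE) (simp_all add: image_image)
  have p1: "poly (progression_poly a k m) 1 = of_nat (m + 1)" by (simp add: poly_progression_poly)
  have \<beta>: "\<beta> = 0"
  proof (rule affine_symmetry_polynomial_circle_linear)
    show "poly (progression_poly a k m) 0 = 0" using assms by (simp add: poly_progression_poly)
    show "progression_poly a k m \<noteq> 0" using p1 by (metis of_nat_eq_0_iff poly_0 add_is_0 one_neq_zero)
    show "\<alpha> \<noteq> 0" using \<alpha> by auto
    show "(\<lambda>w. \<alpha> * w + \<beta>) ` poly (progression_poly a k m) ` sphere 0 1
        \<subseteq> poly (progression_poly a k m) ` sphere 0 1"
      using aff unfolding X_def by (rule equalityD1)
  qed
  \<comment> \<open>The point \<open>m + 1\<close>, the value at 1, goes to a value at some
    \<open>z\<close> of the same modulus. This forces \<open>z ^ k = 1\<close>, and then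
    \<open>\<alpha> = z ^ a\<close>.\<close>
  have "of_nat (m + 1) \<in> X" unfolding X_def p1[symmetric] by (intro imageI) simp
  then have "\<alpha> * of_nat (m + 1) \<in> X" using aff \<beta> by auto
  then obtain z where z: "norm z = 1" "\<alpha> * of_nat (m + 1) = z ^ a * (\<Sum>j\<le>m. (z ^ k) ^ j)"
    by (auto simp: X_def poly_progression_poly)
  have "norm (\<Sum>j\<le>m. (z ^ k) ^ j) = norm (\<alpha> * of_nat (m + 1))"
    unfolding z(2) by (simp add: norm_mult norm_power z(1))
  also have "\<dots> = m + 1" unfolding norm_mult \<alpha> by (simp only: norm_of_nat mult_1)
  finally have zk: "z ^ k = 1"
    using norm_geometric_sum_max[of "z ^ k" m] z(1) \<open>m > 0\<close> by (simp add: norm_power)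
  have "\<alpha> = z ^ a" using z(2) of_nat_neq_0[of m, where ?'a = complex] by (simp add: zk)
  then have "\<alpha> ^ k = 1" using zk by (metis mult.commute power_mult power_one)
  then show "f \<in> (\<lambda>u z. u * z) ` U \<union> (\<lambda>u z. u * cnj z) ` U"
    using f_cases \<beta> by (auto simp: U_def)
next
  fix f :: "complex \<Rightarrow> complex" assume f: "f \<in> (\<lambda>u z. u * z) ` U \<union> (\<lambda>u z. u * cnj z) ` U"
  have sub: "(\<lambda>z. u * z) ` X \<subseteq> X" if u: "u ^ k = 1" for u
  proof -
    \<comment> \<open>Rotating the graph by \<open>u\<close> lifts to rotating the circle by
      \<open>v\<close>.\<close>
    obtain v where v: "v ^ k = 1" "v ^ a = u"
      using root_unity_coprime_power[OF u assms(4,1)] by blast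
    have "u * poly (progression_poly a k m) z = poly (progression_poly a k m) (v * z)" for z
      by (simp add: poly_progression_poly power_mult_distrib v)
    then show ?thesis using norm_root_unity[OF v(1) \<open>k > 0\<close>] by (auto simp: X_def norm_mult)
  qed
  have eq: "(\<lambda>z. u * z) ` X = X" if u: "u ^ k = 1" for u
  proof (rule equalityI[OF sub[OF u]])
    have "u \<noteq> 0" using norm_root_unity[OF u \<open>k > 0\<close>] by auto
    have "(\<lambda>z. inverse u * z) ` X \<subseteq> X" using u by (intro sub) (simp add: power_inverse)
    then show "X \<subseteq> (\<lambda>z. u * z) ` X" using \<open>u \<noteq> 0\<close> by (force simp: image_iff)
  qed
  have "cnj ` X = X" unfolding X_def by (rule cnj_image_progression)
  then have eq': "(\<lambda>z. u * cnj z) ` X = X" if "u ^ k = 1" for u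
    using eq[OF that] by (metis image_image)
  have iso: "plane_isometry (\<lambda>z. u * z)" "plane_isometry (\<lambda>z. u * cnj z)" if "u ^ k = 1" for u
    using norm_root_unity[OF that \<open>k > 0\<close>]
    by (auto simp: plane_isometry_def dist_norm norm_mult
        simp flip: right_diff_distrib complex_cnj_diff)
  show "f \<in> {f. plane_isometry f \<and> f ` X = X}" 
    using f unfolding U_def by (elim UnE imageE CollectE) (simp_all only: eq eq' iso mem_Collect_eq simp_thms)
qed

section \<open>Identification with the dihedral group\<close>

lemma is_dihedral_group_roots_unity:
  assumes "k > 0"
  defines "U \<equiv> {u::complex. u ^ k = 1}"
  shows "is_dihedral_group k (composition_monoid ((\<lambda>u z. u * z) ` U \<union> (\<lambda>u z. u * cnj z) ` U))"
    (is "is_dihedral_group k (composition_monoid (?R \<union> ?F))")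
  unfolding is_dihedral_group_def
proof (intro conjI exI)
  have bij: "bij_betw (\<lambda>j. cis (2 * pi * real j / real k)) {..<k} U"
    unfolding U_def using \<open>k > 0\<close> by (rule bij_betw_roots_unity)
  have U: "(\<lambda>j. cis (2 * pi * real j / real k)) ` {..<k} = U"
    using bij by (rule bij_betw_imp_surj_on)
  have cardU: "card U = k" using bij bij_betw_same_card by fastforce
  have "finite U" using cardU \<open>k > 0\<close> card_gt_0_iff by metis
  have U0: "u \<noteq> 0" if "u \<in> U" for u using that \<open>k > 0\<close> by (auto simp: U_def power_0_left)
  let ?G = "composition_monoid (?R \<union> ?F)"
  show "group ?G"
  proof (rule groupI)
    have mult: "u * v \<in> U" "u * cnj v \<in> U" if "u \<in> U" "v \<in> U" for u v
      using that by (auto simp: U_def power_mult_distrib simp flip: complex_cnj_power)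
    fix f g assume "f \<in> carrier ?G" "g \<in> carrier ?G"
    then show "f \<otimes>\<^bsub>?G\<^esub> g \<in> carrier ?G"
      using mult by (auto simp: composition_monoid_def image_iff fun_eq_iff mult.assoc[symmetric])
  next
    have "id = (\<lambda>z::complex. 1 * z)" "1 \<in> U" by (auto simp: U_def)
    then show "\<one>\<^bsub>?G\<^esub> \<in> carrier ?G" 
      unfolding composition_monoid_def by (metis (no_types, lifting) UnI1 image_eqI monoid.simps(2) partial_object.select_convs(1))
  next
    fix f assume "f \<in> carrier ?G"
    then consider u where "u \<in> U" "f = (\<lambda>z. u * z)" | u where "u \<in> U" "f = (\<lambda>z. u * cnj z)"
      by (auto simp: composition_monoid_def)
    then show "\<exists>g\<in>carrier ?G. g \<otimes>\<^bsub>?G\<^esub> f = \<one>\<^bsub>?G\<^esub>"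
    proof cases
      case 1
      then have "inverse u \<in> U" by (simp add: U_def power_inverse)
      then show ?thesis using 1 U0[of u]
        by (intro bexI[of _ "\<lambda>z. inverse u * z"]) (auto simp: composition_monoid_def)
    next
      case 2
      \<comment> \<open>This makes each reflection its own inverse.\<close>
      then have "u * cnj u = 1"
        using norm_root_unity[of u k] \<open>k > 0\<close> by (simp add: U_def flip: complex_norm_square)
      then show ?thesis using 2
        by (intro bexI[of _ f]) (auto simp: composition_monoid_def fun_eq_iff mult.assoc[symmetric])
    qed
  qed (auto simp: composition_monoid_def)
  have "card (?R \<union> ?F) = card ?R + card ?F"
  proof (rule card_Un_disjoint)
    \<comment> \<open>Evaluation at 1 gives \<open>u = v\<close>, evaluation at \<open>\<i>\<close>
      gives \<open>u = - v\<close>.\<close>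
    have False if "u \<in> U" "(\<lambda>z. u * z) = (\<lambda>z. v * cnj z)" for u v
      using fun_cong[OF that(2), of 1] fun_cong[OF that(2), of \<i>] U0[OF that(1)] by simp
    then show "?R \<inter> ?F = {}" by blast
  qed (use \<open>finite U\<close> in auto)
  also have "card ?R = k"
    using cardU by (subst card_image) (auto intro!: inj_onI dest: fun_cong[of _ _ 1])
  also have "card ?F = k"
    using cardU by (subst card_image) (auto intro!: inj_onI dest: fun_cong[of _ _ 1])
  finally show "Coset.order ?G = 2 * k" by (simp add: Coset.order_def composition_monoid_def)
  \<comment> \<open>The centre is 0. Reflection in the axis at angle \<open>\<theta>\<close> is
    \<open>cnj\<close> followed by multiplication by \<open>cis (2 * \<theta>)\<close>, so the axis
    angles are half the arguments of the roots of unity.\<close>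
  let ?\<Theta> = "(\<lambda>j. pi * real j / real k) ` {..<k}"
  show "?\<Theta> \<subseteq> {0..<pi}" using \<open>k > 0\<close> by (auto simp: field_simps)
  show "card ?\<Theta> = k" using \<open>k > 0\<close> by (subst card_image) (auto intro!: inj_onI)
  have "range (\<lambda>j::int. cis (of_int j * (2 * pi / real k))) = U"
  proof (intro equalityI subsetI)
    fix u assume "u \<in> range (\<lambda>j::int. cis (of_int j * (2 * pi / real k)))"
    then obtain j :: int where u: "u = cis (of_int j * (2 * pi / real k))" by auto
    have "u ^ k = cis (2 * pi * of_int j)" using \<open>k > 0\<close> unfolding u by (simp add: DeMoivre mult_ac)
    then show "u \<in> U" by (simp add: U_def cis_multiple_2pi)
  next
    fix u assume "u \<in> U"
    then obtain j where "u = cis (2 * pi * real j / real k)" using U by auto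
    then have "u = cis (of_int (int j) * (2 * pi / real k))" by (simp add: mult_ac)
    then show "u \<in> range (\<lambda>j::int. cis (of_int j * (2 * pi / real k)))" by blast
  qed
  moreover have "rotation 0 \<phi> = (\<lambda>z. cis \<phi> * z)" for \<phi> by (auto simp: rotation_def)
  ultimately have rot: "range (\<lambda>j::int. rotation 0 (of_int j * (2 * pi / real k))) = ?R"
    by (metis (no_types, lifting) image_image image_cong)
  have "reflection 0 \<theta> = (\<lambda>z. cis (2 * \<theta>) * cnj z)" for \<theta>
    by (auto simp: reflection_def cis_cnj cis_mult mult.assoc[symmetric])
  then have "reflection 0 ` ?\<Theta> = (\<lambda>j z. cis (2 * pi * real j / real k) * cnj z) ` {..<k}"
    by (simp add: image_image mult.assoc)
  also have "\<dots> = ?F" unfolding U[symmetric] by (simp add: image_image)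
  finally show "?G = composition_monoid
      (range (\<lambda>j::int. rotation 0 (of_int j * (2 * pi / real k))) \<union> reflection 0 ` ?\<Theta>)"
    using rot by simp
qed

theorem theorem1:
  fixes a k q m :: nat
  assumes "a > 0" and "k > 0" and "q > 0" and "m > 0"
    and "coprime a k"
  shows "is_dihedral_group k
           (symmetry_group (curve_graph (exp_curve m (\<lambda>j. q * (j * k + a)))))"
  using is_dihedral_group_roots_unity[OF \<open>k > 0\<close>] symmetries_progression[OF assms(1,2,4,5)]
  unfolding symmetry_group_def curve_graph_progression[OF \<open>q > 0\<close>] by simp
end
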